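(* Let $n\ge 3$ and let $(C_n,L)$ be an edge-labeled $n$-cycle with positive integer edge labels $\ell_1,\dots,\ell_n$. Let $\mathcal{G}_0=(1,\dots,1)$ and, for each $1\le k\le n-1$, let $\mathcal{G}_k$ be a smallest flow-up class $\mathcal{G}_k$ on $(C_n,L)$. Then $\mathcal{G}_0,\mathcal{G}_1,\dots,\mathcal{G}_{n-1}$ form a basis over $\mathbb{Z}$ of the $\mathbb{Z}$-module of generalized splines on $(C_n,L)$.
   Context: An edge-labeled $n$-cycle $(C_n,L)$: vertices $v_1,\dots,v_n$; edge $e_i$ joins $v_i$ and $v_{i+1}$ for $1\le i\le n-1$, and $e_n$ joins $v_n$ and $v_1$; edge $e_i$ carries label $\ell_i$. A generalized spline on $(C_n,L)$ is a tuple $(g_1,\dots,g_n)\in\mathbb{Z}^n$ with $g_i\equiv g_{i+1}\pmod{\ell_i}$ for $1\le i\le n-1$ and $g_n\equiv g_1\pmod{\ell_n}$; the splines form a $\mathbb{Z}$-module under componentwise operations. For $1\le k<n$, a flow-up class $\mathcal{G}_k$ is a spline $(0,\dots,0,g_{k+1},\dots,g_n)$ with $k$ leading zeros and $g_{k+1}\ne 0$. A smallest flow-up class $\mathcal{G}_k=(0,\dots,0,g_{k+1},\dots,g_n)$ is a flow-up class whose nonzero entries are positive and such that for every flow-up class $(0,\dots,0,g'_{k+1},\dots,g'_n)$ with positive entries one has $g'_i\ge g_i$ for all $i$. *)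

theory Defs
  imports Complex_Main "HOL-Number_Theory.Cong" "HOL-Library.Function_Algebras"
begin

text \<open>Integer tuples \<open>(g\<^sub>1, \<dots>, g\<^sub>n)\<close> are functions of type \<open>nat \<Rightarrow> int\<close> that vanish
  outside \<open>{1..n}\<close>, so that equality of functions is equality of tuples and the pointwise
  operations are the componentwise ones.\<close>

definition int_tuples :: "nat \<Rightarrow> (nat \<Rightarrow> int) set"
  where "int_tuples n = {g. \<forall>i. i \<notin> {1..n} \<longrightarrow> g i = 0}"

definition ones :: "nat \<Rightarrow> nat \<Rightarrow> int"
  where "ones n = (\<lambda>i. if i \<in> {1..n} then 1 else 0)"

definition int_scale :: "int \<Rightarrow> (nat \<Rightarrow> int) \<Rightarrow> (nat \<Rightarrow> int)"
  where "int_scale c g = (\<lambda>i. c * g i)"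

global_interpretation int_module: module int_scale
  by unfold_locales (auto simp: int_scale_def fun_eq_iff algebra_simps)

definition splines :: "nat \<Rightarrow> (nat \<Rightarrow> int) \<Rightarrow> (nat \<Rightarrow> int) set"
  where "splines n l = {g \<in> int_tuples n.
    (\<forall>i\<in>{1..n - 1}. [g i = g (i + 1)] (mod l i)) \<and> [g n = g 1] (mod l n)}"

lemma subspace_splines: "int_module.subspace (splines n l)"
  unfolding int_module.subspace_def splines_def int_tuples_def int_scale_def
  by (auto intro: cong_add cong_scalar_left)

definition flow_up_class :: "nat \<Rightarrow> (nat \<Rightarrow> int) \<Rightarrow> nat \<Rightarrow> (nat \<Rightarrow> int) \<Rightarrow> bool"
  where "flow_up_class n l k g \<longleftrightarrow>
    1 \<le> k \<and> k < n \<and> g \<in> splines n l \<and> (\<forall>i\<in>{1..k}. g i = 0) \<and> g (k + 1) \<noteq> 0"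

text \<open>Entries after position \<open>k + 1\<close> of a smallest flow-up class may be zero; the classes it is
  compared with have all entries after the leading zeros positive. Allowing zero entries there as
  well would only make the notion more restrictive.\<close>

definition smallest_flow_up_class :: "nat \<Rightarrow> (nat \<Rightarrow> int) \<Rightarrow> nat \<Rightarrow> (nat \<Rightarrow> int) \<Rightarrow> bool"
  where "smallest_flow_up_class n l k g \<longleftrightarrow>
    flow_up_class n l k g \<and> (\<forall>i\<in>{1..n}. g i \<noteq> 0 \<longrightarrow> g i > 0) \<and>
    (\<forall>g'. flow_up_class n l k g' \<and> (\<forall>i\<in>{k + 1..n}. g' i > 0)
       \<longrightarrow> (\<forall>i\<in>{1..n}. g' i \<ge> g i))"

text \<open>Since \<open>independent\<close> is a predicate on sets, injectivity is needed to express the linear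
  independence of an indexed family.\<close>

definition int_basis :: "'i set \<Rightarrow> ('i \<Rightarrow> nat \<Rightarrow> int) \<Rightarrow> (nat \<Rightarrow> int) set \<Rightarrow> bool"
  where "int_basis I b M \<longleftrightarrow>
    inj_on b I \<and> int_module.independent (b ` I) \<and> int_module.span (b ` I) = M"

end

theory Submission
  imports Defs
begin

text \<open>The family is triangular, so it is a basis as soon as the leading entry of each member
  divides the corresponding entry of every spline with the same leading zeros. For a smallest
  flow-up class this holds because the remainder of such a spline modulo the class would otherwise
  have a smaller positive leading entry; adding a large multiple of the product of all labels to
  the entries after the leading one makes them positive without affecting any congruence.\<close>

lemma sum_fun_apply: "(\<Sum>x\<in>A. f x) i = (\<Sum>x\<in>A. f x i)" for f :: "'a \<Rightarrow> 'b \<Rightarrow> 'c::comm_monoid_add"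
  by (induction A rule: infinite_finite_induct) auto

text \<open>For \<open>j < k\<close> the entry at \<open>j + 1\<close> separates the two members: it
  is the leading entry of \<open>b j\<close> and one of the leading zeros of
  \<open>b k\<close>.\<close>

lemma inj_on_triangular:
  fixes b :: "nat \<Rightarrow> nat \<Rightarrow> int"
  assumes "\<And>k i. k < n \<Longrightarrow> 1 \<le> i \<Longrightarrow> i \<le> k \<Longrightarrow> b k i = 0"
    and "\<And>k. k < n \<Longrightarrow> b k (k + 1) \<noteq> 0"
  shows "inj_on b {..<n}"
proof (rule linorder_inj_onI)
  fix j k :: nat assume "j < k" "j \<in> {..<n}" "k \<in> {..<n}"
  then have "b k (j + 1) = 0" "b j (j + 1) \<noteq> 0"
    using assms by auto
  then show "b j \<noteq> b k" by metis
qed auto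

lemma independent_triangular:
  fixes b :: "nat \<Rightarrow> nat \<Rightarrow> int"
  assumes zero: "\<And>k i. k < n \<Longrightarrow> 1 \<le> i \<Longrightarrow> i \<le> k \<Longrightarrow> b k i = 0"
    and nonzero: "\<And>k. k < n \<Longrightarrow> b k (k + 1) \<noteq> 0"
  shows "int_module.independent (b ` {..<n})"
proof
  assume "int_module.dependent (b ` {..<n})"
  then obtain u where ex: "\<exists>v\<in>b ` {..<n}. u v \<noteq> 0"
    and sum0: "(\<Sum>v\<in>b ` {..<n}. int_scale (u v) v) = 0"
    by (auto simp: int_module.dependent_finite)
  \<comment> \<open>The least index with a nonzero coefficient: evaluating the relation at entry
    \<open>k + 1\<close> isolates the term of \<open>b k\<close>.\<close>
  define k where "k = (LEAST k. k < n \<and> u (b k) \<noteq> 0)"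
  have "\<exists>k. k < n \<and> u (b k) \<noteq> 0" using ex by auto
  then have k: "k < n" "u (b k) \<noteq> 0"
    unfolding k_def by (metis (mono_tags, lifting) LeastI_ex)+
  have below: "u (b j) = 0" if "j < k" for j
    using that k(1) not_less_Least[of j "\<lambda>k. k < n \<and> u (b k) \<noteq> 0"] unfolding k_def by auto
  have "inj_on b {..<n}"
    using zero nonzero by (rule inj_on_triangular)
  \<comment> \<open>Coefficients are attached to tuples; injectivity turns the sum over the image
    into a sum over indices.\<close>
  then have "(\<Sum>j<n. int_scale (u (b j)) (b j)) = 0"
    using sum0 by (simp add: sum.reindex)
  then have "0 = (\<Sum>j<n. int_scale (u (b j)) (b j)) (k + 1)"
    by simp
  also have "\<dots> = (\<Sum>j<n. u (b j) * b j (k + 1))"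
    by (simp add: sum_fun_apply int_scale_def)
  also have "\<dots> = (\<Sum>j\<in>{k}. u (b j) * b j (k + 1))"
  proof (rule sum.mono_neutral_right)
    show "\<forall>j\<in>{..<n} - {k}. u (b j) * b j (k + 1) = 0"
    proof
      fix j assume j: "j \<in> {..<n} - {k}"
      \<comment> \<open>Terms before \<open>k\<close> vanish by their coefficient, terms after
        \<open>k\<close> because entry \<open>k + 1\<close> is among the leading zeros of
        \<open>b j\<close>.\<close>
      then consider "j < k" | "k + 1 \<le> j" by force
      then show "u (b j) * b j (k + 1) = 0"
        using below zero j by cases auto
    qed
  qed (use k in auto)
  finally show False
    using k nonzero by simp
qed

text \<open>Elimination by descending induction on the number \<open>k\<close> of leading zeros:
  subtracting a suitable multiple of \<open>b k\<close> clears entry \<open>k + 1\<close>, and after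
  \<open>n\<close> cleared entries only the zero tuple is left.\<close>

lemma triangular_in_span:
  fixes b :: "nat \<Rightarrow> nat \<Rightarrow> int"
  assumes sub: "int_module.subspace M" and tup: "M \<subseteq> int_tuples n"
    and mem: "\<And>k. k < n \<Longrightarrow> b k \<in> M"
    and zero: "\<And>k i. k < n \<Longrightarrow> 1 \<le> i \<Longrightarrow> i \<le> k \<Longrightarrow> b k i = 0"
    and dvd: "\<And>k h. k < n \<Longrightarrow> h \<in> M \<Longrightarrow> \<forall>i\<in>{1..k}. h i = 0 \<Longrightarrow> b k (k + 1) dvd h (k + 1)"
    and "k \<le> n" "h \<in> M" "\<forall>i\<in>{1..k}. h i = 0"
  shows "h \<in> int_module.span (b ` {..<n})"
  using \<open>k \<le> n\<close> \<open>h \<in> M\<close> \<open>\<forall>i\<in>{1..k}. h i = 0\<close>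
proof (induction k arbitrary: h rule: inc_induct)
  case base
  then have "h i = 0" for i
    using tup unfolding int_tuples_def by (cases "i \<in> {1..n}") auto
  then have "h = 0" by (simp add: fun_eq_iff)
  then show ?case by (simp only: int_module.span_zero)
next
  case (step k)
  obtain c where c: "h (k + 1) = b k (k + 1) * c"
    using dvd[OF _ step.prems] step.hyps by (auto elim: dvdE)
  let ?r = "h - int_scale c (b k)"
  have "?r \<in> M"
    using sub mem step
    by (intro int_module.subspace_diff int_module.subspace_scale) auto
  moreover have "\<forall>i\<in>{1..Suc k}. ?r i = 0"
  proof
    fix i assume "i \<in> {1..Suc k}"
    then show "?r i = 0"
      using c zero step by (cases "i = k + 1") (auto simp: int_scale_def)
  qed
  ultimately have "?r \<in> int_module.span (b ` {..<n})"
    by (rule step.IH)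
  moreover have "int_scale c (b k) \<in> int_module.span (b ` {..<n})"
    using step.hyps by (intro int_module.span_scale int_module.span_base) auto
  ultimately have "?r + int_scale c (b k) \<in> int_module.span (b ` {..<n})"
    by (rule int_module.span_add)
  then show ?case by simp
qed

lemma int_basis_triangular:
  fixes b :: "nat \<Rightarrow> nat \<Rightarrow> int"
  assumes sub: "int_module.subspace M" and tup: "M \<subseteq> int_tuples n"
    and mem: "\<And>k. k < n \<Longrightarrow> b k \<in> M"
    and zero: "\<And>k i. k < n \<Longrightarrow> 1 \<le> i \<Longrightarrow> i \<le> k \<Longrightarrow> b k i = 0"
    and nonzero: "\<And>k. k < n \<Longrightarrow> b k (k + 1) \<noteq> 0"
    and dvd: "\<And>k h. k < n \<Longrightarrow> h \<in> M \<Longrightarrow> \<forall>i\<in>{1..k}. h i = 0 \<Longrightarrow> b k (k + 1) dvd h (k + 1)"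
  shows "int_basis {..<n} b M"
  unfolding int_basis_def
proof (intro conjI subset_antisym)
  show "inj_on b {..<n}"
    using zero nonzero by (rule inj_on_triangular)
  show "int_module.independent (b ` {..<n})"
    using zero nonzero by (rule independent_triangular)
  show "int_module.span (b ` {..<n}) \<subseteq> M"
    using mem sub by (intro int_module.span_minimal) auto
  show "M \<subseteq> int_module.span (b ` {..<n})"
  proof
    fix h assume "h \<in> M"
    show "h \<in> int_module.span (b ` {..<n})"
      using sub tup mem zero dvd
      by (rule triangular_in_span[where k = 0]) (use \<open>h \<in> M\<close> in auto)
  qed
qed

text \<open>Each label divides the product of all labels, so the added terms are 0 modulo every
  label and may be chosen freely at each vertex.\<close>

lemma prod_labels_perturbation_in_splines:
  assumes "n \<ge> 1" and h: "h \<in> splines n l" and "\<And>i. i \<notin> {1..n} \<Longrightarrow> c i = 0"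
  shows "(\<lambda>i. h i + c i * (\<Prod>j=1..n. l j)) \<in> splines n l"
proof -
  let ?L = "\<Prod>j=1..n. l j"
  \<comment> \<open>Arbitrary positions \<open>i\<close> and \<open>j\<close> let this cover the
    closing edge from \<open>n\<close> to 1 as well.\<close>
  have cong: "[h i + c i * ?L = h j + c j * ?L] (mod l m)"
    if "m \<in> {1..n}" "[h i = h j] (mod l m)" for i j m
  proof -
    have "l m dvd ?L" using that by (intro dvd_prodI) auto
    then have "[c i * ?L = c j * ?L] (mod l m)"
      by (simp add: cong_def mod_eq_0_iff_dvd)
    then show ?thesis using that by (intro cong_add)
  qed
  have "[h i + c i * ?L = h (i + 1) + c (i + 1) * ?L] (mod l i)" if "i \<in> {1..n - 1}" for i
    using that h unfolding splines_def by (intro cong) auto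
  moreover have "[h n + c n * ?L = h 1 + c 1 * ?L] (mod l n)"
    using h \<open>n \<ge> 1\<close> unfolding splines_def by (intro cong) auto
  ultimately show ?thesis
    using assms(2,3) unfolding splines_def int_tuples_def by simp
qed

lemma smallest_flow_up_class_dvd:
  assumes pos: "\<forall>i\<in>{1..n}. l i > 0" and small: "smallest_flow_up_class n l k g"
    and h: "h \<in> splines n l" "\<forall>i\<in>{1..k}. h i = 0"
  shows "g (k + 1) dvd h (k + 1)"
proof (rule ccontr)
  assume ndvd: "\<not> g (k + 1) dvd h (k + 1)"
  have k: "1 \<le> k" "k < n" and g: "g \<in> splines n l" "\<forall>i\<in>{1..k}. g i = 0" "g (k + 1) > 0"
    using small unfolding smallest_flow_up_class_def flow_up_class_def by auto
  define r where "r = h - int_scale (h (k + 1) div g (k + 1)) g"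
  have r: "r \<in> splines n l"
    unfolding r_def
    using h g by (intro int_module.subspace_diff int_module.subspace_scale subspace_splines)
  have r_zero: "\<forall>i\<in>{1..k}. r i = 0"
    using h g by (auto simp: r_def int_scale_def)
  have r_lead: "r (k + 1) = h (k + 1) mod g (k + 1)"
    by (simp add: r_def int_scale_def minus_div_mult_eq_mod)
  then have r_bounds: "0 < r (k + 1)" "r (k + 1) < g (k + 1)"
    using ndvd pos_mod_sign[OF g(3)] pos_mod_bound[OF g(3)]
    by (simp_all add: dvd_eq_mod_eq_0 order_less_le)
  let ?L = "\<Prod>j=1..n. l j"
  have "?L > 0" using pos by (intro prod_pos) auto
  \<comment> \<open>Starting at \<open>k + 2\<close> preserves the leading zeros and the leading
    entry \<open>r (k + 1)\<close>. Since \<open>?L\<close> is at least 1, the factor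
    \<open>\<bar>r i\<bar> + 1\<close> outweighs a negative \<open>r i\<close>.\<close>
  define c where "c i = (if i \<in> {k + 2..n} then \<bar>r i\<bar> + 1 else 0)" for i
  define g' where "g' i = r i + c i * ?L" for i
  have "g' \<in> splines n l"
    unfolding g'_def using k r
    by (intro prod_labels_perturbation_in_splines) (auto simp: c_def)
  moreover have g'_lead: "g' (k + 1) = r (k + 1)"
    by (simp add: g'_def c_def)
  moreover have "\<forall>i\<in>{1..k}. g' i = 0"
    using r_zero by (simp add: g'_def c_def)
  ultimately have "flow_up_class n l k g'"
    using k r_bounds by (simp add: flow_up_class_def)
  moreover have "g' i > 0" if i: "i \<in> {k + 1..n}" for i
  proof (cases "i = k + 1")
    case True
    then show ?thesis using g'_lead r_bounds by simp
  next
    case False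
    have "\<bar>r i\<bar> + 1 \<le> (\<bar>r i\<bar> + 1) * ?L"
      using \<open>?L > 0\<close> mult_left_mono[of 1 ?L "\<bar>r i\<bar> + 1"] by simp
    moreover have "c i = \<bar>r i\<bar> + 1"
      using False i by (simp add: c_def)
    ultimately show ?thesis
      unfolding g'_def by (simp only:)
  qed
  \<comment> \<open>Minimality of \<open>g\<close> against \<open>g'\<close> contradicts that the
    leading entry of \<open>g'\<close> is a remainder modulo \<open>g (k + 1)\<close>.\<close>
  ultimately have "g (k + 1) \<le> g' (k + 1)"
    using small k unfolding smallest_flow_up_class_def by simp
  then show False
    using g'_lead r_bounds by simp
qed

theorem theorem4p7:
  fixes n :: nat and l :: "nat \<Rightarrow> int" and G :: "nat \<Rightarrow> nat \<Rightarrow> int"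
  assumes "n \<ge> 3"
    and "\<forall>i\<in>{1..n}. l i > 0"
    and "G 0 = ones n"
    and "\<forall>k\<in>{1..n - 1}. smallest_flow_up_class n l k (G k)"
  shows "int_basis {0..n - 1} G (splines n l)"
proof -
  have small: "smallest_flow_up_class n l k (G k)" if "k < n" "k \<noteq> 0" for k
    using that assms(4) by auto
  have flow: "flow_up_class n l k (G k)" if "k < n" "k \<noteq> 0" for k
    using small[OF that] by (simp add: smallest_flow_up_class_def)
  have "int_basis {..<n} G (splines n l)"
  proof (rule int_basis_triangular)
    show "int_module.subspace (splines n l)" by (rule subspace_splines)
    show "splines n l \<subseteq> int_tuples n" by (auto simp: splines_def)
  next
    fix k assume "k < n"
    then show "G k \<in> splines n l"
      using flow[of k] assms(1,3)
      by (cases "k = 0") (auto simp: flow_up_class_def splines_def int_tuples_def ones_def)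
    show "G k (k + 1) \<noteq> 0"
      using \<open>k < n\<close> flow[of k] assms(3) by (cases "k = 0") (auto simp: flow_up_class_def ones_def)
  next
    fix k i :: nat assume "k < n" "1 \<le> i" "i \<le> k"
    then show "G k i = 0"
      using flow[of k] by (auto simp: flow_up_class_def)
  next
    fix k h assume "k < n" "h \<in> splines n l" "\<forall>i\<in>{1..k}. h i = 0"
    \<comment> \<open>For \<open>k = 0\<close> the leading entry is 1, which divides every
      integer.\<close>
    then show "G k (k + 1) dvd h (k + 1)"
      using smallest_flow_up_class_dvd[OF assms(2) small] assms(1,3)
      by (cases "k = 0") (auto simp: ones_def)
  qed
  moreover have "{0..n - 1} = {..<n}"
    using assms(1) by auto
  ultimately show ?thesis by simp
qed

end
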